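(* Let $\alpha=\{k_1,k_2\}$ with positive integers $k_1,k_2$, and let $A\in\mathbb{R}^{(k_1+k_2)\times(k_1+k_2)}$ be $\alpha$-partitioned, $$A=\begin{pmatrix} A_{11} & A_{12} \\ A_{21} & A_{22} \end{pmatrix},\qquad A_{ij}\in\mathbb{R}^{k_i\times k_j},$$ with $A_{11}$ and $A_{22}$ Hurwitz. Let $K_1(s)=-(sI-A_{11})^{-1}A_{12}$ and $K_2(s)=(sI-A_{22})^{-1}A_{21}$. If there exists $\gamma>0$ such that $\|K_1\|_{\mathbb{H}_\infty}<1/\gamma$ and $\|K_2\|_{\mathbb{H}_\infty}<\gamma$, then $A$ is $\alpha$-diagonally stable.
   Context: A real square matrix is Hurwitz if all its eigenvalues have negative real part. $\|B\|_2$ denotes the maximum singular value of a matrix $B$. For a stable transfer matrix $G$ (here a proper rational matrix function with all poles in the open left half-plane), $\|G\|_{\mathbb{H}_\infty}=\sup_{s\in\mathbb{C}:\,\mathrm{Re}(s)\ge 0}\|G(s)\|_2=\sup_{\omega\in\mathbb{R}}\|G(\jmath\omega)\|_2$. An $\alpha=\{k_1,k_2\}$-partitioned matrix $X$ with blocks $X_{ij}\in\mathbb{R}^{k_i\times k_j}$ is $\alpha$-diagonal if $X_{ij}=0$ for $i\neq j$. A matrix $A$ is $\alpha$-diagonally stable if there exists an $\alpha$-diagonal symmetric positive definite matrix $X$ such that $AX+XA^T$ is negative definite. *)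

theory Defs
  imports "HOL-Analysis.Analysis"
begin

text \<open>A matrix with \<open>k\<^sub>1\<close> rows and \<open>k\<^sub>2\<close> columns has type \<open>'a ^ 'k2 ^ 'k1\<close>.  The square
  partitioned matrices are indexed by the sum type \<open>'k1 + 'k2\<close>, whose two summands are the two
  classes of the partition.\<close>

definition block11 :: "'a ^ ('k1::finite + 'k2::finite) ^ ('k1 + 'k2) \<Rightarrow> 'a ^ 'k1 ^ 'k1"
  where "block11 M = (\<chi> i j. M $ Inl i $ Inl j)"

definition block12 :: "'a ^ ('k1::finite + 'k2::finite) ^ ('k1 + 'k2) \<Rightarrow> 'a ^ 'k2 ^ 'k1"
  where "block12 M = (\<chi> i j. M $ Inl i $ Inr j)"

definition block21 :: "'a ^ ('k1::finite + 'k2::finite) ^ ('k1 + 'k2) \<Rightarrow> 'a ^ 'k1 ^ 'k2"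
  where "block21 M = (\<chi> i j. M $ Inr i $ Inl j)"

definition block22 :: "'a ^ ('k1::finite + 'k2::finite) ^ ('k1 + 'k2) \<Rightarrow> 'a ^ 'k2 ^ 'k2"
  where "block22 M = (\<chi> i j. M $ Inr i $ Inr j)"

definition conj_transpose :: "complex ^ 'n ^ 'm \<Rightarrow> complex ^ 'm ^ 'n"
  where "conj_transpose M = (\<chi> i j. cnj (M $ j $ i))"

definition is_eigenvalue :: "complex ^ 'n ^ 'n \<Rightarrow> complex \<Rightarrow> bool"
  where "is_eigenvalue M \<mu> \<longleftrightarrow> (\<exists>v. v \<noteq> 0 \<and> M *v v = \<mu> *s v)"

definition hurwitz :: "real ^ 'n ^ 'n \<Rightarrow> bool"
  where "hurwitz M \<longleftrightarrow> (\<forall>\<mu>. is_eigenvalue (map_matrix complex_of_real M) \<mu> \<longrightarrow> Re \<mu> < 0)"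

definition singular_values :: "complex ^ 'n ^ 'm \<Rightarrow> real set"
  where "singular_values M =
    {\<sigma>. 0 \<le> \<sigma> \<and> is_eigenvalue (conj_transpose M ** M) (complex_of_real (\<sigma>\<^sup>2))}"

text \<open>The set of singular values is finite and nonempty.  For a wide matrix, forming it from
  \<open>M\<^sup>* M\<close> instead of \<open>M M\<^sup>*\<close> can only add the value 0, which does not change the maximum.\<close>

definition norm2 :: "complex ^ 'n ^ 'm \<Rightarrow> real"
  where "norm2 M = Max (singular_values M)"

text \<open>The supremum is taken in the extended reals, so it is meaningful whether or not the
  transfer matrix is bounded on the closed right half-plane.\<close>

definition hinf_norm :: "(complex \<Rightarrow> complex ^ 'n ^ 'm) \<Rightarrow> ereal"
  where "hinf_norm G = (SUP s \<in> {s. 0 \<le> Re s}. ereal (norm2 (G s)))"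

text \<open>\<open>K\<^sub>1\<close> and \<open>K\<^sub>2\<close>.  If the respective diagonal block is Hurwitz, the matrix being inverted is
  invertible whenever \<open>0 \<le> Re s\<close>; elsewhere \<open>matrix_inv\<close> may be applied to a singular matrix,
  but those \<open>s\<close> do not enter the norm.\<close>

definition K1 :: "real ^ ('k1::finite + 'k2::finite) ^ ('k1 + 'k2) \<Rightarrow> complex \<Rightarrow> complex ^ 'k2 ^ 'k1"
  where "K1 A s =
    - (matrix_inv (mat s - map_matrix complex_of_real (block11 A)) ** map_matrix complex_of_real (block12 A))"

definition K2 :: "real ^ ('k1::finite + 'k2::finite) ^ ('k1 + 'k2) \<Rightarrow> complex \<Rightarrow> complex ^ 'k1 ^ 'k2"
  where "K2 A s =
    matrix_inv (mat s - map_matrix complex_of_real (block22 A)) ** map_matrix complex_of_real (block21 A)"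

definition positive_definite :: "real ^ 'n ^ 'n \<Rightarrow> bool"
  where "positive_definite M \<longleftrightarrow> transpose M = M \<and> (\<forall>x. x \<noteq> 0 \<longrightarrow> 0 < x \<bullet> (M *v x))"

definition negative_definite :: "real ^ 'n ^ 'n \<Rightarrow> bool"
  where "negative_definite M \<longleftrightarrow> transpose M = M \<and> (\<forall>x. x \<noteq> 0 \<longrightarrow> x \<bullet> (M *v x) < 0)"

definition alpha_diagonal :: "real ^ ('k1::finite + 'k2::finite) ^ ('k1 + 'k2) \<Rightarrow> bool"
  where "alpha_diagonal X \<longleftrightarrow> block12 X = 0 \<and> block21 X = 0"

definition alpha_diagonally_stable :: "real ^ ('k1::finite + 'k2::finite) ^ ('k1 + 'k2) \<Rightarrow> bool"
  where "alpha_diagonally_stable A \<longleftrightarrow>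
    (\<exists>X. alpha_diagonal X \<and> positive_definite X \<and> negative_definite (A ** X + X ** transpose A))"

end

theory Submission
  imports Defs "HOL-Computational_Algebra.Fundamental_Theorem_Algebra"
begin

text \<open>The proof combines convex duality with a frequency-domain energy estimate; it does not construct
  solutions of Riccati equations.

  It is enough to find a symmetric block-diagonal \<open>X\<close> with \<open>X A + A\<^sup>T X < 0\<close>. Its blocks satisfy the Lyapunov
  inequalities of the Hurwitz matrices \<open>A\<^sub>1\<^sub>1\<close> and \<open>A\<^sub>2\<^sub>2\<close>, so \<open>X\<close> is automatically positive
  definite (\<open>lyapunov_positive\<close>), and \<open>P = X\<^sup>-\<^sup>1\<close> is block-diagonal, positive definite and satisfies
  \<open>A P + P A\<^sup>T < 0\<close>.

  If no such \<open>X\<close> exists, separation of convex sets (\<open>block_lyapunov_alternative\<close>) yields finitely many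
  vectors \<open>x\<^sub>i = (f\<^sub>i, g\<^sub>i)\<close>, not all zero, such that for \<open>(w\<^sub>i, w'\<^sub>i) = A x\<^sub>i\<close> both \<open>\<Sum> w\<^sub>i f\<^sub>i\<^sup>T\<close> and
  \<open>\<Sum> w'\<^sub>i g\<^sub>i\<^sup>T\<close> are skew-symmetric. Consider the first block, where \<open>w\<^sub>i = A\<^sub>1\<^sub>1 f\<^sub>i + A\<^sub>1\<^sub>2 g\<^sub>i\<close>. A skew-Hermitian
  matrix has imaginary spectrum, so after a unitary recombination of the index set the family consists of solutions of
  \<open>A\<^sub>1\<^sub>1 f + A\<^sub>1\<^sub>2 g = \<i> \<omega> f\<close> (together with members having \<open>f = 0\<close>), that is \<open>f = - K\<^sub>1(\<i> \<omega>) g\<close>. Summing norms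
  gives \<open>\<Sum> |f\<^sub>i|\<^sup>2 \<le> \<kappa>\<^sub>1\<^sup>2 * \<Sum> |g\<^sub>i|\<^sup>2\<close> with \<open>\<kappa>\<^sub>1 < 1 / \<gamma>\<close> (\<open>frequency_domain_energy_bound\<close>). The second block
  gives the reverse estimate with \<open>\<kappa>\<^sub>2 < \<gamma>\<close>. As \<open>\<kappa>\<^sub>1 \<kappa>\<^sub>2 < 1\<close>, all \<open>x\<^sub>i\<close> vanish, a contradiction. The two
  blocks may use different frequencies and different recombinations: only total energies are compared.\<close>

section \<open>A variational principle for pairs of self-adjoint maps\<close>

text \<open>If \<open>x \<bullet> K x = 0\<close>, then \<open>x\<close> minimises the quadratic form of \<open>K\<close>; a small step from \<open>x\<close> in the
  direction \<open>- K x\<close> would make the form negative unless \<open>K x = 0\<close>.\<close>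

lemma psd_zero_imp_kernel:
  fixes K :: "'a::real_inner \<Rightarrow> 'a"
  assumes lin: "linear K" and sa: "\<And>x y. K x \<bullet> y = x \<bullet> K y"
    and psd: "\<And>x. 0 \<le> x \<bullet> K x" and zero: "x \<bullet> K x = 0"
  shows "K x = 0"
proof (rule ccontr)
  assume "K x \<noteq> 0"
  define a where "a = K x \<bullet> K x"
  define c where "c = K x \<bullet> K (K x)"
  \<comment> \<open>near the minimiser \<open>- a / c\<close> of \<open>t \<mapsto> 2 * t * a + t\<^sup>2 * c\<close>, with \<open>c + 1\<close> because \<open>c\<close> may vanish\<close>
  define t where "t = - a / (c + 1)"
  have a: "a > 0" using \<open>K x \<noteq> 0\<close> by (simp add: a_def)
  have c: "c \<ge> 0" using psd by (simp add: c_def)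
  have "0 \<le> (x + t *\<^sub>R K x) \<bullet> K (x + t *\<^sub>R K x)" by (rule psd)
  also have "\<dots> = 2 * t * a + t\<^sup>2 * c"
    using zero sa[of x "K x"]
    by (simp add: linear_add[OF lin] linear_cmul[OF lin] inner_add_left inner_add_right
        a_def c_def power2_eq_square algebra_simps)
  also have "\<dots> = - t\<^sup>2 * (c + 2)"
  proof -
    have a_eq: "a = - t * (c + 1)" using c by (simp add: t_def)
    show ?thesis by (subst a_eq) (simp add: power2_eq_square algebra_simps)
  qed
  also have "\<dots> < 0" using a c by (simp add: t_def)
  finally show False by simp
qed

text \<open>A maximiser of the Rayleigh quotient \<open>(x \<bullet> K x) / (x \<bullet> H x)\<close> is a generalised eigenvector.
  The form of \<open>H\<close> is only semidefinite, so the quotient is maximised over unit vectors orthogonal to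
  the kernel of \<open>H\<close>; there it is continuous. The kernel condition makes both forms insensitive to the
  kernel component, which turns the maximum into a bound on the whole space: \<open>\<omega> H - K\<close> is then
  positive semidefinite and its form vanishes at the maximiser.\<close>

lemma maximal_generalized_eigenvector:
  fixes H K :: "'a::euclidean_space \<Rightarrow> 'a"
  assumes linH: "linear H" and saH: "\<And>x y. H x \<bullet> y = x \<bullet> H y" and psd: "\<And>x. 0 \<le> x \<bullet> H x"
    and linK: "linear K" and saK: "\<And>x y. K x \<bullet> y = x \<bullet> K y"
    and ker: "\<And>x. H x = 0 \<Longrightarrow> K x = 0" and nz: "H z \<noteq> 0"
  obtains \<omega> y where "K y = \<omega> *\<^sub>R H y" "H y \<noteq> 0" "\<And>x. x \<bullet> K x \<le> \<omega> * (x \<bullet> H x)"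
proof -
  define V where "V = {x. H x = 0}"
  have subV: "subspace V" unfolding V_def by (rule linear_subspace_kernel[OF linH])
  define W where "W = {x. \<forall>v\<in>V. v \<bullet> x = 0}"
  have closedW: "closed W"
  proof -
    have "W = (\<Inter>v\<in>V. {x. v \<bullet> x = 0})" by (auto simp: W_def)
    then show ?thesis by (auto intro!: closed_INT simp: closed_hyperplane)
  qed
  have decomp: "\<exists>v u. v \<in> V \<and> u \<in> W \<and> x = v + u" for x
  proof -
    obtain v u where "v \<in> span V" "\<And>w. w \<in> span V \<Longrightarrow> orthogonal u w" "x = v + u"
      using orthogonal_subspace_decomp_exists[of V x] by blast
    moreover have "span V = V" using subV by (simp add: span_eq_iff)
    ultimately have "v \<in> V" "u \<in> W" by (auto simp: W_def orthogonal_def inner_commute)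
    then show ?thesis using \<open>x = v + u\<close> by blast
  qed
  have reduceH: "(v + u) \<bullet> H (v + u) = u \<bullet> H u" if "v \<in> V" for u v
    using that saH[of v u] by (simp add: V_def linear_add[OF linH] inner_add_left)
  have reduceK: "(v + u) \<bullet> K (v + u) = u \<bullet> K u" if "v \<in> V" for u v
    using that saK[of v u] ker[of v] by (simp add: V_def linear_add[OF linK] inner_add_left)
  have pos: "0 < x \<bullet> H x" if "x \<in> W" "x \<noteq> 0" for x
  proof -
    have "H x \<noteq> 0" using that by (auto simp: W_def V_def)
    then have "x \<bullet> H x \<noteq> 0" using psd_zero_imp_kernel[OF linH saH psd] by blast
    then show ?thesis using psd[of x] by linarith
  qed
  obtain v0 u0 where u0: "v0 \<in> V" "u0 \<in> W" "z = v0 + u0" using decomp by blast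
  have "u0 \<noteq> 0" using u0 nz by (auto simp: V_def)
  have scaleW: "c *\<^sub>R x \<in> W" if "x \<in> W" for c x using that by (auto simp: W_def)
  define S where "S = sphere 0 1 \<inter> W"
  define r where "r = (\<lambda>x. (x \<bullet> K x) / (x \<bullet> H x))"
  have contH: "continuous_on S H" and contK: "continuous_on S K"
    using linH linK by (simp_all add: linear_continuous_on linear_conv_bounded_linear)
  have SW: "x \<in> W" "x \<noteq> 0" if "x \<in> S" for x using that by (auto simp: S_def)
  have "compact S" unfolding S_def using closedW by (simp add: compact_Int_closed)
  moreover have "(1 / norm u0) *\<^sub>R u0 \<in> S"
    using u0 \<open>u0 \<noteq> 0\<close> scaleW by (simp add: S_def)
  moreover have "continuous_on S r" unfolding r_def
    using pos SW
    by (intro continuous_on_divide continuous_on_inner continuous_on_id contH contK)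
      (simp add: less_imp_neq[symmetric])
  ultimately obtain y where y: "y \<in> S" "\<And>x. x \<in> S \<Longrightarrow> r x \<le> r y"
    using continuous_attains_sup[of S r] by blast
  define \<omega> where "\<omega> = r y"
  have bound: "x \<bullet> K x \<le> \<omega> * (x \<bullet> H x)" for x
  proof -
    obtain v u where vu: "v \<in> V" "u \<in> W" "x = v + u" using decomp by blast
    have "u \<bullet> K u \<le> \<omega> * (u \<bullet> H u)"
    proof (cases "u = 0")
      case True then show ?thesis by simp
    next
      case False
      then have "(1 / norm u) *\<^sub>R u \<in> S" using vu scaleW by (simp add: S_def)
      then have "r ((1 / norm u) *\<^sub>R u) \<le> \<omega>" using y by (simp add: \<omega>_def)
      moreover have "r ((1 / norm u) *\<^sub>R u) = r u"
        using False by (simp add: r_def linear_cmul[OF linH] linear_cmul[OF linK])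
      ultimately have "(u \<bullet> K u) / (u \<bullet> H u) \<le> \<omega>" by (simp only: r_def)
      then show ?thesis using pos[OF vu(2) False] by (simp only: pos_divide_le_eq)
    qed
    then show ?thesis using vu reduceH reduceK by simp
  qed
  have Hy: "0 < y \<bullet> H y" using pos SW y by blast
  have "linear (\<lambda>x. \<omega> *\<^sub>R H x - K x)"
    by (intro linear_compose_sub linear_compose_scale_right linH linK)
  moreover have "y \<bullet> (\<omega> *\<^sub>R H y - K y) = 0"
    using Hy by (simp add: \<omega>_def r_def inner_diff_right)
  ultimately have "\<omega> *\<^sub>R H y - K y = 0"
    using bound by (intro psd_zero_imp_kernel[of "\<lambda>x. \<omega> *\<^sub>R H x - K x"])
      (simp_all add: inner_diff_left inner_diff_right saH saK)
  then have "K y = \<omega> *\<^sub>R H y" by simp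
  moreover have "H y \<noteq> 0" using Hy by auto
  ultimately show ?thesis using that bound by blast
qed

section \<open>Hermitian products and singular values\<close>

text \<open>The type \<open>complex ^ 'n\<close> carries the real inner product \<open>x \<bullet> y\<close>, which is the real part of the Hermitian
  product below. Compactness arguments use the former, scalar multiplication by \<open>\<i>\<close> needs the latter.\<close>

definition hdot :: "complex ^ 'n \<Rightarrow> complex ^ 'n \<Rightarrow> complex"
  where "hdot x y = (\<Sum>k\<in>UNIV. cnj (x $ k) * y $ k)"

lemma Re_hdot: "Re (hdot x y) = x \<bullet> y"
  by (simp add: hdot_def inner_vec_def inner_complex_def)

lemma cnj_hdot: "cnj (hdot x y) = hdot y x"
  by (simp add: hdot_def mult.commute)

lemma hdot_add_left: "hdot (x + x') y = hdot x y + hdot x' y"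
  and hdot_add_right: "hdot x (y + y') = hdot x y + hdot x y'"
  and hdot_diff_left: "hdot (x - x') y = hdot x y - hdot x' y"
  and hdot_diff_right: "hdot x (y - y') = hdot x y - hdot x y'"
  by (simp_all add: hdot_def algebra_simps sum.distrib sum_subtractf)

lemma hdot_cmult_left: "hdot (c *s x) y = cnj c * hdot x y"
  and hdot_cmult_right: "hdot x (c *s y) = c * hdot x y"
  by (simp_all add: hdot_def sum_distrib_left mult_ac)

lemma hdot_zero [simp]: "hdot 0 y = 0" "hdot x 0 = 0"
  by (simp_all add: hdot_def)

lemma hdot_sum_left: "hdot (\<Sum>i\<in>I. f i) y = (\<Sum>i\<in>I. hdot (f i) y)"
  by (induction I rule: infinite_finite_induct) (simp_all add: hdot_add_left)

lemma hdot_sum_right: "hdot x (\<Sum>i\<in>I. f i) = (\<Sum>i\<in>I. hdot x (f i))"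
  by (induction I rule: infinite_finite_induct) (simp_all add: hdot_add_right)

lemma hdot_self: "hdot x x = complex_of_real ((norm x)\<^sup>2)"
proof -
  have "Im (hdot x x) = 0" using cnj_hdot[of x x] by (simp add: complex_eq_iff)
  then show ?thesis using Re_hdot[of x x] by (simp add: complex_eq_iff power2_norm_eq_inner)
qed

lemma scaleR_eq_cmult: "r *\<^sub>R x = complex_of_real r *s x"
  by (simp add: vec_eq_iff) (simp add: scaleR_conv_of_real)

lemma hdot_conj_transpose: "hdot x (conj_transpose M *v y) = hdot (M *v x) y"
proof -
  have "hdot x (conj_transpose M *v y) = (\<Sum>j\<in>UNIV. \<Sum>i\<in>UNIV. cnj (x $ j) * cnj (M $ i $ j) * y $ i)"
    by (simp add: hdot_def conj_transpose_def matrix_vector_mult_def sum_distrib_left mult.assoc)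
  also have "\<dots> = (\<Sum>i\<in>UNIV. \<Sum>j\<in>UNIV. cnj (x $ j) * cnj (M $ i $ j) * y $ i)"
    by (rule sum.swap)
  also have "\<dots> = hdot (M *v x) y"
    by (simp add: hdot_def matrix_vector_mult_def sum_distrib_left mult_ac)
  finally show ?thesis .
qed

lemma inner_conj_transpose: "x \<bullet> (conj_transpose M *v y) = (M *v x) \<bullet> y"
  using hdot_conj_transpose[of x M y] by (metis Re_hdot)

text \<open>Eigenvectors of the Hermitian matrix \<open>M\<^sup>* M\<close> for different eigenvalues are orthogonal, so there are
  only finitely many eigenvalues. Without finiteness the maximum in \<open>norm2\<close> would be an unspecified
  number.\<close>

lemma finite_singular_values: "finite (singular_values M)"
proof -
  let ?N = "conj_transpose M ** M"
  let ?P = "\<lambda>\<sigma> v. v \<noteq> 0 \<and> ?N *v v = complex_of_real (\<sigma>\<^sup>2) *s v"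
  define e where "e = (\<lambda>\<sigma>. SOME v. ?P \<sigma> v)"
  have e: "?P \<sigma> (e \<sigma>)" if "\<sigma> \<in> singular_values M" for \<sigma>
    using that unfolding e_def singular_values_def is_eigenvalue_def by (intro someI_ex[of "?P \<sigma>"]) auto
  have orth: "e \<sigma> \<bullet> e \<tau> = 0"
    if st: "\<sigma> \<in> singular_values M" "\<tau> \<in> singular_values M" "\<sigma> \<noteq> \<tau>" for \<sigma> \<tau>
  proof -
    have "\<sigma>\<^sup>2 \<noteq> \<tau>\<^sup>2" using st by (auto simp: singular_values_def power2_eq_iff)
    have "\<tau>\<^sup>2 * (e \<sigma> \<bullet> e \<tau>) = e \<sigma> \<bullet> (?N *v e \<tau>)"
      using e[OF st(2)] by (metis inner_scaleR_right scaleR_eq_cmult)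
    also have "\<dots> = (M *v e \<sigma>) \<bullet> (M *v e \<tau>)"
      by (simp add: inner_conj_transpose flip: matrix_vector_mul_assoc)
    also have "\<dots> = (?N *v e \<sigma>) \<bullet> e \<tau>"
      by (metis inner_commute inner_conj_transpose matrix_vector_mul_assoc)
    also have "\<dots> = \<sigma>\<^sup>2 * (e \<sigma> \<bullet> e \<tau>)"
      using e[OF st(1)] by (metis inner_scaleR_left scaleR_eq_cmult)
    finally show ?thesis using \<open>\<sigma>\<^sup>2 \<noteq> \<tau>\<^sup>2\<close> by simp
  qed
  have inj: "inj_on e (singular_values M)"
    using orth e by (metis inj_onI inner_eq_zero_iff)
  have "pairwise orthogonal (e ` singular_values M)"
    using orth by (auto simp: pairwise_def orthogonal_def) 
  moreover have "0 \<notin> e ` singular_values M" using e by auto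
  ultimately have "finite (e ` singular_values M)"
    by (metis pairwise_orthogonal_independent independent_imp_finite)
  then show ?thesis using inj finite_imageD by blast
qed

text \<open>The largest value of \<open>(norm (M *v x))\<^sup>2\<close> on the unit sphere is the top eigenvalue of \<open>M\<^sup>* M\<close>, by the
  variational principle with \<open>H\<close> the identity; its square root is one of the singular values.\<close>

lemma norm_matrix_vector_le_norm2:
  fixes M :: "complex ^ 'n ^ 'm"
  shows "0 \<le> norm2 M" and "norm (M *v x) \<le> norm2 M * norm x"
proof -
  let ?N = "conj_transpose M ** M"
  have quad: "v \<bullet> (?N *v w) = (M *v v) \<bullet> (M *v w)" for v w
    by (simp add: inner_conj_transpose flip: matrix_vector_mul_assoc)
  have lin: "linear (\<lambda>v. ?N *v v)"
    by (rule linearI) (simp_all add: matrix_vector_right_distrib scaleR_eq_cmult vector_scalar_commute)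
  obtain b :: "complex ^ 'n" where "b \<noteq> 0" by (metis SOME_Basis nonzero_Basis)
  obtain \<omega> y where y: "?N *v y = \<omega> *\<^sub>R y" "y \<noteq> 0" "\<And>x. x \<bullet> (?N *v x) \<le> \<omega> * (x \<bullet> x)"
    by (rule maximal_generalized_eigenvector[of "\<lambda>x. x" "\<lambda>v. ?N *v v" b])
      (use lin \<open>b \<noteq> 0\<close> in \<open>auto simp: linear_ident quad\<close>, metis inner_commute quad)
  have "\<omega> * (y \<bullet> y) = (M *v y) \<bullet> (M *v y)" using y(1) quad[of y y] by simp
  then have "0 \<le> \<omega> * (y \<bullet> y)" by simp
  then have \<omega>: "0 \<le> \<omega>" using y(2) by (metis inner_gt_zero_iff zero_le_mult_iff not_less)
  then have "sqrt \<omega> \<in> singular_values M"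
    using y by (auto simp: singular_values_def is_eigenvalue_def scaleR_eq_cmult simp del: of_real_power)
  then have le: "sqrt \<omega> \<le> norm2 M" unfolding norm2_def by (simp add: finite_singular_values)
  then show "0 \<le> norm2 M" using \<omega> by (meson order_trans real_sqrt_ge_zero)
  have "(norm (M *v x))\<^sup>2 \<le> \<omega> * (norm x)\<^sup>2"
    using y(3)[of x] by (simp add: quad power2_norm_eq_inner)
  then have "norm (M *v x) \<le> sqrt \<omega> * norm x"
    using real_le_rsqrt by (fastforce simp: real_sqrt_mult)
  also have "\<dots> \<le> norm2 M * norm x" using le by (simp add: mult_right_mono)
  finally show "norm (M *v x) \<le> norm2 M * norm x" .
qed

section \<open>The energy estimate in the frequency domain\<close>

text \<open>For a sesquilinear form whose diagonal values are imaginary, evaluating the diagonal at \<open>\<i> x + y\<close> isolates the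
  imaginary parts of the off-diagonal values. This is what makes \<open>\<i> W F\<^sup>*\<close> Hermitian below.\<close>

lemma skew_hermitian_polarization:
  assumes add_l: "\<And>x y z. B (x + y) z = B x z + B y z" and add_r: "\<And>x y z. B z (x + y) = B z x + B z y"
    and mult_l: "\<And>c x y. B (c *s x) y = cnj c * B x y" and mult_r: "\<And>c x y. B x (c *s y) = c * B x y"
    and diag: "\<And>y::complex ^ 'n. Re (B y y) = 0"
  shows "Im (B x y) = Im (B y x)"
  using diag[of "\<i> *s x + y"] diag[of x] diag[of y]
  by (simp add: add_l add_r mult_l mult_r)

text \<open>In matrix language, with rows \<open>a\<close> and \<open>b\<close> and the column vector \<open>z\<close>: the columns are replaced by their
  images under the projection onto the orthogonal complement of \<open>z\<close>. The Gram product \<open>a b\<^sup>*\<close> then loses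
  precisely the rank-one term \<open>(a z) (b z)\<^sup>* / norm z\<^sup>2\<close>.\<close>

lemma sum_deflate:
  fixes a b z :: "'i \<Rightarrow> complex"
  assumes c: "c = (\<Sum>i\<in>I. (cmod (z i))\<^sup>2)" "c \<noteq> 0"
  defines "a0 \<equiv> \<Sum>i\<in>I. z i * a i" and "b0 \<equiv> \<Sum>i\<in>I. z i * b i"
  shows "(\<Sum>i\<in>I. (a i - cnj (z i) / c * a0) * cnj (b i - cnj (z i) / c * b0))
    = (\<Sum>i\<in>I. a i * cnj (b i)) - a0 * cnj b0 / c"
proof -
  have zz: "(\<Sum>i\<in>I. cnj (z i) * z i) = c"
    unfolding c(1) of_real_sum by (intro sum.cong refl) (simp add: complex_norm_square mult.commute del: of_real_power)
  have b0: "cnj b0 = (\<Sum>i\<in>I. cnj (z i) * cnj (b i))" by (simp add: b0_def)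
  have "(\<Sum>i\<in>I. (a i - cnj (z i) / c * a0) * cnj (b i - cnj (z i) / c * b0))
    = (\<Sum>i\<in>I. a i * cnj (b i) - (z i * a i) * (cnj b0 / c) - (cnj (z i) * cnj (b i)) * (a0 / c)
        + (cnj (z i) * z i) * (a0 * cnj b0 / (c * c)))"
    by (intro sum.cong refl) (simp add: algebra_simps)
  also have "\<dots> = (\<Sum>i\<in>I. a i * cnj (b i)) - a0 * (cnj b0 / c) - cnj b0 * (a0 / c)
        + c * (a0 * cnj b0 / (c * c))"
    by (simp only: sum.distrib sum_subtractf sum_distrib_right[symmetric] zz b0[symmetric] a0_def[symmetric])
  also have "\<dots> = (\<Sum>i\<in>I. a i * cnj (b i)) - a0 * cnj b0 / c"
    using c(2) by (simp add: field_simps)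
  finally show ?thesis .
qed

lemma sum_norm_deflate:
  fixes f :: "'i \<Rightarrow> complex ^ 'n" and z :: "'i \<Rightarrow> complex"
  assumes c: "c = (\<Sum>i\<in>I. (cmod (z i))\<^sup>2)" "c \<noteq> 0"
  shows "(\<Sum>i\<in>I. (norm (f i - (cnj (z i) / c) *s (\<Sum>j\<in>I. z j *s f j)))\<^sup>2)
    = (\<Sum>i\<in>I. (norm (f i))\<^sup>2) - (norm (\<Sum>j\<in>I. z j *s f j))\<^sup>2 / c"
proof -
  let ?f0 = "\<Sum>j\<in>I. z j *s f j"
  let ?f' = "\<lambda>i. f i - (cnj (z i) / c) *s ?f0"
  have hd: "hdot v v = (\<Sum>k\<in>UNIV. v $ k * cnj (v $ k))" for v :: "complex ^ 'n"
    by (simp add: hdot_def mult.commute)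
  have "(\<Sum>i\<in>I. hdot (?f' i) (?f' i)) = (\<Sum>k\<in>UNIV. \<Sum>i\<in>I. ?f' i $ k * cnj (?f' i $ k))"
    unfolding hd by (rule sum.swap)
  also have "\<dots> = (\<Sum>k\<in>UNIV. (\<Sum>i\<in>I. f i $ k * cnj (f i $ k)) - ?f0 $ k * cnj (?f0 $ k) / c)"
    using sum_deflate[OF assms, of "\<lambda>i. f i $ k" "\<lambda>i. f i $ k" for k] by (simp add: sum_component)
  also have "\<dots> = (\<Sum>i\<in>I. hdot (f i) (f i)) - hdot ?f0 ?f0 / c"
    unfolding hd by (simp add: sum_subtractf sum_divide_distrib sum.swap[of _ I])
  finally have "complex_of_real (\<Sum>i\<in>I. (norm (?f' i))\<^sup>2)
      = complex_of_real ((\<Sum>i\<in>I. (norm (f i))\<^sup>2) - (norm ?f0)\<^sup>2 / c)"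
    by (simp add: hdot_self)
  then show ?thesis by (simp only: of_real_eq_iff)
qed

text \<open>The frequency-domain half of the argument. Think of the \<open>f i\<close>, \<open>g i\<close> as the columns of matrices \<open>F\<close>, \<open>G\<close>,
  and let \<open>W = A F + B G\<close>. The hypothesis \<open>skew\<close> says that \<open>W F\<^sup>*\<close> is skew-Hermitian. If it
  happened that all \<open>W\<close>-columns were imaginary multiples of the corresponding \<open>F\<close>-columns, every pair
  \<open>(f i, g i)\<close> would satisfy the frequency bound and the claim would follow by summation.

  In general such columns are split off one at a time. Put \<open>H = F F\<^sup>*\<close> and \<open>K = \<i> W F\<^sup>*\<close>. Both are
  Hermitian, and \<open>H\<close> is positive semidefinite with kernel that of \<open>F\<^sup>*\<close>, hence contained in that of \<open>K\<close>.
  A generalised eigenvector \<open>K y = \<omega> H y\<close> gives coefficients \<open>z = F\<^sup>* y\<close> for which \<open>W z = - \<i> \<omega> F z\<close>, so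
  \<open>u = F z\<close> and \<open>v = G z\<close> obey the frequency bound. Projecting all columns away from \<open>z\<close> lowers the two energies
  by \<open>norm u\<^sup>2 / norm z\<^sup>2\<close> and \<open>norm v\<^sup>2 / norm z\<^sup>2\<close>. It preserves skewness, because
  the removed term \<open>(W z) (F z)\<^sup>*\<close> is itself skew-Hermitian, and it
  adds \<open>y\<close> to the kernel of \<open>F\<^sup>*\<close>; so the dimension of this kernel drives an induction that ends
  with \<open>F = 0\<close>.\<close>

lemma frequency_domain_energy_bound:
  fixes A :: "complex ^ 'k ^ 'k" and B :: "complex ^ 'm ^ 'k"
    and f :: "'i \<Rightarrow> complex ^ 'k" and g :: "'i \<Rightarrow> complex ^ 'm"
  assumes I: "finite I"
    and skew: "\<And>y. Re (\<Sum>i\<in>I. hdot y (A *v f i + B *v g i) * hdot (f i) y) = 0"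
    and freq: "\<And>\<omega> u v. A *v u + B *v v = (\<i> * complex_of_real \<omega>) *s u \<Longrightarrow> norm u \<le> \<kappa> * norm v"
  shows "(\<Sum>i\<in>I. (norm (f i))\<^sup>2) \<le> \<kappa>\<^sup>2 * (\<Sum>i\<in>I. (norm (g i))\<^sup>2)"
  using skew
proof (induction "DIM(complex ^ 'k) - dim {y. \<forall>i\<in>I. hdot (f i) y = 0}" arbitrary: f g rule: less_induct)
  case less
  define ker where "ker = (\<lambda>f::'i \<Rightarrow> complex ^ 'k. {y. \<forall>i\<in>I. hdot (f i) y = 0})"
  define w where "w i = A *v f i + B *v g i" for i
  define H where "H y = (\<Sum>i\<in>I. hdot (f i) y *s f i)" for y
  define K where "K y = (\<Sum>i\<in>I. (\<i> * hdot (f i) y) *s w i)" for y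
  have linH: "linear H" unfolding H_def
    by (intro linearI)
      (simp_all add: hdot_add_right scaleR_eq_cmult hdot_cmult_right vector_sadd_rdistrib sum.distrib vec.scale_sum_right)
  have linK: "linear K" unfolding K_def
    by (intro linearI)
      (simp_all add: hdot_add_right scaleR_eq_cmult hdot_cmult_right vector_sadd_rdistrib sum.distrib vec.scale_sum_right distrib_left mult_ac)
  have hdotH: "hdot x (H y) = (\<Sum>i\<in>I. hdot x (f i) * hdot (f i) y)" for x y
    by (simp add: H_def hdot_sum_right hdot_cmult_right mult.commute)
  have hdotK: "hdot x (K y) = \<i> * (\<Sum>i\<in>I. hdot x (w i) * hdot (f i) y)" for x y
    by (simp add: K_def hdot_sum_right hdot_cmult_right sum_distrib_left mult_ac)
  have saH: "H x \<bullet> y = x \<bullet> H y" for x y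
  proof -
    have "cnj (hdot y (H x)) = hdot x (H y)" by (simp add: hdotH cnj_hdot mult.commute)
    then have "Re (hdot y (H x)) = Re (hdot x (H y))" by (metis cnj.sel(1))
    then show ?thesis by (simp add: Re_hdot inner_commute)
  qed
  have saK: "K x \<bullet> y = x \<bullet> K y" for x y
  proof -
    have "Im (\<Sum>i\<in>I. hdot x (w i) * hdot (f i) y) = Im (\<Sum>i\<in>I. hdot y (w i) * hdot (f i) x)"
      by (rule skew_hermitian_polarization)
        (use less.prems in \<open>simp_all add: w_def hdot_add_left hdot_add_right hdot_cmult_left
          hdot_cmult_right algebra_simps sum.distrib sum_distrib_left\<close>)
    then have "y \<bullet> K x = x \<bullet> K y" by (simp add: hdotK flip: Re_hdot)
    then show ?thesis by (simp add: inner_commute)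
  qed
  have innerH: "y \<bullet> H y = (\<Sum>i\<in>I. (cmod (hdot (f i) y))\<^sup>2)" for y
  proof -
    have "hdot y (H y) = (\<Sum>i\<in>I. complex_of_real ((cmod (hdot (f i) y))\<^sup>2))"
      unfolding hdotH complex_norm_square by (simp add: cnj_hdot mult.commute)
    then show ?thesis by (simp flip: Re_hdot)
  qed
  have H0: "hdot (f i) y = 0" if "H y = 0" "i \<in> I" for i y
    using innerH[of y] that I by (simp add: sum_nonneg_eq_0_iff)
  show ?case
  proof (cases "\<forall>z. H z = 0")
    case True
    then have "f i = 0" if "i \<in> I" for i
      using H0[of "f i" i] that by (simp add: hdot_self)
    then show ?thesis by (simp add: sum_nonneg)
  next
    case False
    then obtain z0 where z0: "H z0 \<noteq> 0" by blast
    obtain \<omega> y where y: "K y = \<omega> *\<^sub>R H y" "H y \<noteq> 0"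
    proof (rule maximal_generalized_eigenvector[of H K z0, OF linH saH _ linK saK])
      show "0 \<le> x \<bullet> H x" for x by (simp add: innerH sum_nonneg)
      show "K x = 0" if "H x = 0" for x using H0[OF that] by (simp add: K_def)
    qed (use z0 in blast)+
    define z where "z i = hdot (f i) y" for i
    define c where "c = (\<Sum>i\<in>I. (cmod (z i))\<^sup>2)"
    define u where "u = (\<Sum>i\<in>I. z i *s f i)"
    define v where "v = (\<Sum>i\<in>I. z i *s g i)"
    have u: "u = H y" by (simp add: u_def H_def z_def)
    have c: "c \<noteq> 0" 
      using innerH[of y] y(2) psd_zero_imp_kernel[OF linH saH, of y] innerH
      by (force simp: c_def z_def sum_nonneg)
    have c0: "c > 0" using c by (simp add: c_def sum_nonneg order_le_neq_trans)
    have Avu: "A *v u + B *v v = (\<Sum>i\<in>I. z i *s w i)"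
      by (simp add: u_def v_def w_def vec.sum vector_scalar_commute
          vector_add_ldistrib sum.distrib)
    have "\<i> *s (\<Sum>i\<in>I. z i *s w i) = complex_of_real \<omega> *s u"
      using y(1) by (simp add: K_def u z_def scaleR_eq_cmult vector_smult_assoc vec.scale_sum_right)
    then have "(- \<i>) *s (\<i> *s (\<Sum>i\<in>I. z i *s w i)) = (- \<i>) *s (complex_of_real \<omega> *s u)" by simp
    then have wu: "(\<Sum>i\<in>I. z i *s w i) = (\<i> * complex_of_real (- \<omega>)) *s u"
      by (simp add: vector_smult_assoc)
    have uv: "norm u \<le> \<kappa> * norm v" using freq[of u v "- \<omega>"] by (simp add: Avu wu)
    then have uv2: "(norm u)\<^sup>2 \<le> \<kappa>\<^sup>2 * (norm v)\<^sup>2"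
      using power_mono[OF uv norm_ge_zero, of 2] by (simp add: power_mult_distrib)
    define f' where "f' i = f i - (cnj (z i) / c) *s u" for i
    define g' where "g' i = g i - (cnj (z i) / c) *s v" for i
    have w': "A *v f' i + B *v g' i = w i - (cnj (z i) / c) *s (A *v u + B *v v)" for i
      by (simp add: f'_def g'_def w_def matrix_vector_mult_diff_distrib vector_scalar_commute
          vector_add_ldistrib vector_ssub_ldistrib)
    have skew': "Re (\<Sum>i\<in>I. hdot x (A *v f' i + B *v g' i) * hdot (f' i) x) = 0" for x
    proof -
      have "(\<Sum>i\<in>I. hdot x (A *v f' i + B *v g' i) * hdot (f' i) x)
        = (\<Sum>i\<in>I. (hdot x (w i) - cnj (z i) / c * (\<Sum>i\<in>I. z i * hdot x (w i)))
            * cnj (hdot x (f i) - cnj (z i) / c * (\<Sum>i\<in>I. z i * hdot x (f i))))"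
        by (intro sum.cong refl arg_cong2[where f = "(*)"])
          (simp add: w' Avu hdot_diff_right hdot_cmult_right hdot_sum_right,
            simp add: f'_def u_def hdot_diff_left hdot_cmult_left hdot_sum_left cnj_hdot)
      also have "\<dots> = (\<Sum>i\<in>I. hdot x (w i) * hdot (f i) x) - hdot x (\<Sum>i\<in>I. z i *s w i) * cnj (hdot x u) / c"
        using sum_deflate[OF c_def c, of "\<lambda>i. hdot x (w i)" "\<lambda>i. hdot x (f i)"]
        by (simp add: u_def hdot_sum_right hdot_cmult_right cnj_hdot)
      also have "hdot x (\<Sum>i\<in>I. z i *s w i) * cnj (hdot x u) = - \<i> * \<omega> * complex_of_real ((cmod (hdot x u))\<^sup>2)"
        unfolding wu hdot_cmult_right complex_norm_square by simp
      finally show ?thesis using less.prems[of x] by (simp add: w_def)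
    qed
    have "ker f \<subset> ker f'"
    proof
      show "ker f \<subseteq> ker f'"
        by (auto simp: ker_def f'_def u_def hdot_diff_left hdot_cmult_left hdot_sum_left)
      have "hdot u y = c"
        unfolding u_def c_def of_real_sum hdot_sum_left
        by (intro sum.cong refl) (simp add: hdot_cmult_left z_def complex_norm_square mult.commute del: of_real_power)
      then have "y \<in> ker f'"
        using c by (auto simp: ker_def f'_def hdot_diff_left hdot_cmult_left z_def)
      moreover have "H y = 0" if "y \<in> ker f" using that by (simp add: ker_def H_def)
      then have "y \<notin> ker f" using y(2) by blast
      ultimately show "ker f \<noteq> ker f'" by blast
    qed
    moreover have "subspace (ker h)" for h
      by (auto simp: subspace_def ker_def hdot_add_right hdot_cmult_right scaleR_eq_cmult)
    ultimately have "dim (ker f) < dim (ker f')" by (metis dim_psubset span_eq_iff)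
    moreover have "dim (ker f') \<le> DIM(complex ^ 'k)" by (rule dim_subset_UNIV)
    ultimately have "(\<Sum>i\<in>I. (norm (f' i))\<^sup>2) \<le> \<kappa>\<^sup>2 * (\<Sum>i\<in>I. (norm (g' i))\<^sup>2)"
      using skew' unfolding ker_def by (intro less.hyps) auto
    moreover have "(\<Sum>i\<in>I. (norm (f' i))\<^sup>2) = (\<Sum>i\<in>I. (norm (f i))\<^sup>2) - (norm u)\<^sup>2 / c"
      using sum_norm_deflate[OF c_def c, of f] by (simp add: f'_def u_def)
    moreover have "(\<Sum>i\<in>I. (norm (g' i))\<^sup>2) = (\<Sum>i\<in>I. (norm (g i))\<^sup>2) - (norm v)\<^sup>2 / c"
      using sum_norm_deflate[OF c_def c, of g] by (simp add: g'_def v_def)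
    moreover have "(norm u)\<^sup>2 / c \<le> \<kappa>\<^sup>2 * ((norm v)\<^sup>2 / c)"
      using uv2 c0 by (simp add: divide_right_mono)
    ultimately show ?thesis by (simp add: right_diff_distrib)
  qed
qed

section \<open>Positivity of Lyapunov forms of stable matrices\<close>

text \<open>The usual minimal-polynomial proof that eigenvectors exist, carried out modulo \<open>V\<close>: among the nonzero
  polynomials \<open>p\<close> with \<open>p(M) v \<in> V\<close> take one of least degree, split off a root \<open>\<nu>\<close> as \<open>p = (X - \<nu>) q\<close>, and use
  \<open>q(M) v\<close>.\<close>

lemma eigenvector_modulo_invariant_subspace:
  fixes M :: "complex ^ 'n ^ 'n"
  assumes V: "vec.subspace V" and v: "v \<notin> V"
  obtains x \<nu> where "x \<notin> V" "M *v x - \<nu> *s x \<in> V"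
proof -
  \<comment> \<open>polynomials of degree at most the real dimension suffice, and a fixed summation range makes
    evaluation linear in the coefficients\<close>
  define N where "N = DIM(complex ^ 'n)"
  define u where "u i = ((*v) M ^^ i) v" for i
  have u_Suc: "M *v u i = u (Suc i)" for i by (simp add: u_def)
  \<comment> \<open>\<open>p(M) v\<close>\<close>
  define P where "P p = (\<Sum>i\<le>N. coeff p i *s u i)" for p
  have P_shift: "P (pCons 0 q) = M *v P q" if "degree q < N" for q
  proof -
    have "P (pCons 0 q) = (\<Sum>i<N. coeff q i *s u (Suc i))"
      unfolding P_def lessThan_Suc_atMost[symmetric] sum.lessThan_Suc_shift by simp
    also have "\<dots> = (\<Sum>i\<le>N. coeff q i *s u (Suc i))"
      using coeff_eq_0[OF that] by (simp add: lessThan_Suc_atMost[symmetric])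
    finally show ?thesis by (simp add: P_def vec.sum vector_scalar_commute u_Suc)
  qed
  have P_linear: "P (p - smult c q) = P p - c *s P q" for p q c
    by (simp add: P_def vector_sub_rdistrib sum_subtractf vec.scale_sum_right)
  define good where "good p \<longleftrightarrow> p \<noteq> 0 \<and> degree p \<le> N \<and> P p \<in> V" for p
  have "\<exists>p. good p"
  proof (cases "inj_on u {..N}")
    case True
    have "dependent (u ` {..N})"
      by (rule dependent_biggerset) (use True in \<open>simp_all add: card_image N_def\<close>)
    then obtain c w where cw: "w \<in> u ` {..N}" "c w \<noteq> 0" "(\<Sum>w\<in>u ` {..N}. c w *\<^sub>R w) = 0"
      by (auto simp: dependent_finite)
    define p where "p = (\<Sum>i\<le>N. monom (complex_of_real (c (u i))) i)"
    have coeff_p: "coeff p i = (if i \<le> N then complex_of_real (c (u i)) else 0)" for i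
      by (simp add: p_def coeff_sum)
    have "p \<noteq> 0" using cw(1,2) coeff_p[of "inv_into {..N} u w"]
      by (metis True atMost_iff coeff_0 f_inv_into_f inv_into_into of_real_eq_0_iff)
    moreover have "degree p \<le> N" by (intro degree_le) (simp add: coeff_p)
    moreover have "P p = 0"
      using cw(3) True by (simp add: P_def coeff_p sum.reindex scaleR_eq_cmult)
    ultimately show ?thesis using vec.subspace_0[OF V] by (auto simp: good_def)
  next
    case False
    then obtain i j where ij: "i \<le> N" "j \<le> N" "i \<noteq> j" "u i = u j" by (auto simp: inj_on_def)
    let ?p = "monom 1 i - smult 1 (monom 1 j) :: complex poly"
    have "coeff ?p i \<noteq> 0" using ij by simp
    then have "?p \<noteq> 0" by (metis coeff_0)
    moreover have "degree ?p \<le> N" using ij by (intro degree_diff_le) (auto intro: order_trans[OF degree_monom_le])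
    moreover have "P (monom 1 k) = u k" if "k \<le> N" for k
    proof -
      have "P (monom 1 k) = (\<Sum>i\<le>N. if i = k then u i else 0)"
        unfolding P_def by (intro sum.cong) auto
      then show ?thesis using that by simp
    qed
    then have "P ?p = 0" using ij P_linear[of "monom 1 i" 1 "monom 1 j"] by simp
    ultimately show ?thesis using vec.subspace_0[OF V] unfolding good_def by (intro exI[of _ ?p]) simp
  qed
  then obtain p where p: "good p" and minimal: "\<And>q. good q \<Longrightarrow> degree p \<le> degree q"
    using ex_has_least_nat[of good _ degree] by blast
  have "degree p \<noteq> 0"
  proof
    assume "degree p = 0"
    then obtain a where a: "p = [:a:]" by (metis degree_eq_zeroE)
    then have "P p = a *s v"
      by (simp add: P_def sum.atMost_shift u_def)
    then have "(1 / a) *s (a *s v) \<in> V" using p V by (metis good_def vec.subspace_scale)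
    then show False using v a p by (simp add: good_def)
  qed
  then obtain \<nu> where "poly p \<nu> = 0"
    using fundamental_theorem_of_algebra[of p] constant_degree[of p] by auto
  then obtain q where q: "p = [:-\<nu>, 1:] * q" by (metis dvdE poly_eq_0_iff_dvd)
  have "q \<noteq> 0" using q p by (auto simp: good_def)
  then have deg: "degree p = Suc (degree q)" unfolding q by (subst degree_mult_eq) auto
  then have "\<not> good q" using minimal[of q] by auto
  then have "P q \<notin> V" using \<open>q \<noteq> 0\<close> deg p by (auto simp: good_def)
  moreover have "M *v P q - \<nu> *s P q \<in> V"
  proof -
    have "p = pCons 0 q - smult \<nu> q" by (simp add: q)
    then have "P p = M *v P q - \<nu> *s P q" using P_linear P_shift deg p by (simp add: good_def)
    then show ?thesis using p by (simp add: good_def)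
  qed
  ultimately show ?thesis using that by blast
qed

lemma mat_vector_mult: "mat c *v x = c *s x" for c :: "'a::comm_ring_1"
  by (simp add: mat_def matrix_vector_mult_def vec_eq_iff if_distrib if_distribR cong: if_cong)

text \<open>The algebraic half of Lyapunov's inertia theorem, without matrix exponentials. Let \<open>q\<close> be the Hermitian form of
  \<open>X\<close>. For an eigenvector \<open>M x = \<nu> x\<close> the decay condition reads \<open>Re \<nu> * q x x < 0\<close>, so stability forces
  \<open>q x x > 0\<close>. To reach all vectors, take a largest \<open>M\<close>-invariant subspace \<open>V\<close> on which \<open>q\<close> is positive
  and whose \<open>q\<close>-orthogonal complement spans the rest. If \<open>V\<close> is proper, there is an eigenvector of \<open>M\<close> modulo
  \<open>V\<close>; chosen \<open>q\<close>-orthogonal to \<open>V\<close> it satisfies the same computation, and can be added to \<open>V\<close>.\<close>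

lemma lyapunov_form_positive:
  fixes M X :: "complex ^ 'n ^ 'n"
  assumes stable: "\<And>\<mu>. is_eigenvalue M \<mu> \<Longrightarrow> Re \<mu> < 0"
    and herm: "\<And>x y. hdot x (X *v y) = cnj (hdot y (X *v x))"
    and decay: "\<And>x. x \<noteq> 0 \<Longrightarrow> Re (hdot x (X *v (M *v x))) < 0"
    and "x \<noteq> 0"
  shows "0 < Re (hdot x (X *v x))"
proof -
  define q where "q x y = hdot x (X *v y)" for x y
  have q_simps: "q (x + y) z = q x z + q y z" "q z (x + y) = q z x + q z y"
    "q z (x - y) = q z x - q z y"
    "q (c *s x) y = cnj c * q x y" "q x (c *s y) = c * q x y" "q 0 x = 0" "q x 0 = 0" for x y z c
    by (simp_all add: q_def hdot_add_left hdot_add_right hdot_diff_right hdot_cmult_left hdot_cmult_right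
        matrix_vector_right_distrib matrix_vector_mult_diff_distrib vector_scalar_commute)
  have q_cnj: "q x y = cnj (q y x)" for x y unfolding q_def by (rule herm)
  have q_real: "Im (q x x) = 0" for x
    using arg_cong[OF q_cnj[of x x], of Im] by simp
  define good where "good V \<longleftrightarrow> vec.subspace V \<and> (\<forall>x\<in>V. M *v x \<in> V) \<and>
    (\<forall>x\<in>V. x \<noteq> 0 \<longrightarrow> 0 < Re (q x x)) \<and> (\<forall>x. \<exists>v\<in>V. \<forall>u\<in>V. q u (x - v) = 0)" for V
  have "good {0}" by (auto simp: good_def vec.subspace_def q_simps)
  moreover have "vec.dim W < Suc (CARD('n))" for W :: "(complex ^ 'n) set"
    using vec.dim_subset[of W UNIV] by (simp only: vec_dim_card less_Suc_eq_le subset_UNIV simp_thms)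
  ultimately obtain V where V: "good V" and maximal: "\<And>W. good W \<Longrightarrow> vec.dim W \<le> vec.dim V"
    using ex_has_greatest_nat[of good "{0}" vec.dim "Suc (CARD('n))"] by blast
  have subV: "vec.subspace V" and invV: "\<And>x. x \<in> V \<Longrightarrow> M *v x \<in> V"
    and posV: "\<And>x. x \<in> V \<Longrightarrow> x \<noteq> 0 \<Longrightarrow> 0 < Re (q x x)"
    and projV: "\<And>x. \<exists>v\<in>V. \<forall>u\<in>V. q u (x - v) = 0"
    using V by (auto simp: good_def)
  note clV = vec.subspace_add[OF subV] vec.subspace_diff[OF subV] vec.subspace_scale[OF subV] vec.subspace_0[OF subV]
  have "y \<in> V" for y
  proof (rule ccontr)
    assume "y \<notin> V"
    then obtain x1 \<nu> where x1: "x1 \<notin> V" "M *v x1 - \<nu> *s x1 \<in> V"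
      using eigenvector_modulo_invariant_subspace[OF subV] by blast
    obtain v1 where v1: "v1 \<in> V" "\<And>u. u \<in> V \<Longrightarrow> q u (x1 - v1) = 0" using projV by blast
    define x where "x = x1 - v1"
    define w where "w = M *v x - \<nu> *s x"
    have orth1: "q u x = 0" if "u \<in> V" for u using v1(2)[OF that] by (simp add: x_def)
    have orth2: "q x u = 0" if "u \<in> V" for u using orth1[OF that] by (subst q_cnj) simp
    note orth = orth1 orth2
    have "x \<notin> V" using x1(1) v1(1) clV(1)[of x v1] by (auto simp: x_def)
    then have "x \<noteq> 0" using clV by auto
    have "w = (M *v x1 - \<nu> *s x1) - (M *v v1 - \<nu> *s v1)"
      by (simp add: w_def x_def matrix_vector_mult_diff_distrib vector_ssub_ldistrib)
    then have w: "w \<in> V" using x1(2) v1(1) invV clV by metis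
    have Mx: "M *v x = \<nu> *s x + w" by (simp add: w_def)
    \<comment> \<open>otherwise \<open>M - \<nu>\<close> is injective and so maps \<open>V\<close> onto \<open>V\<close>, which pulls \<open>x\<close> into \<open>V\<close>\<close>
    have "Re \<nu> < 0"
    proof (rule ccontr)
      assume "\<not> Re \<nu> < 0"
      then have not_ev: "\<not> is_eigenvalue M \<nu>" using stable by blast
      define T where "T = M - mat \<nu>"
      have T: "T *v z = M *v z - \<nu> *s z" for z
        by (simp add: T_def matrix_vector_mult_diff_rdistrib mat_vector_mult)
      have kerT: "z = 0" if "T *v z = 0" for z
        using not_ev that by (auto simp: T is_eigenvalue_def)
      then have "inj ((*v) T)" by (metis (no_types, lifting) injI matrix_vector_mult_diff_distrib right_minus_eq)
      then have "vec.dim ((*v) T ` V) = vec.dim V"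
        by (intro vec.dim_image_eq) (auto simp: inj_on_def)
      moreover have "(*v) T ` V \<subseteq> V" using invV clV by (auto simp: T)
      ultimately have "(*v) T ` V = V"
        using subV
        by (intro vec.subspace_dim_equal vec.linear_subspace_image[OF matrix_vector_mul_linear_gen]) auto
      then obtain v' where v': "v' \<in> V" "w = T *v v'" using w by blast
      then have "T *v (x - v') = 0" by (simp add: matrix_vector_mult_diff_distrib T w_def)
      then show False using kerT[of "x - v'"] v'(1) \<open>x \<notin> V\<close> by auto
    qed
    have "q x (M *v x) = \<nu> * q x x" by (simp add: Mx q_simps orth w)
    then have "Re (q x (M *v x)) = Re \<nu> * Re (q x x)" by (simp add: q_real)
    moreover have "Re (q x (M *v x)) < 0" using decay[OF \<open>x \<noteq> 0\<close>] by (simp add: q_def)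
    ultimately have qx: "0 < Re (q x x)" using \<open>Re \<nu> < 0\<close> by (simp add: mult_less_0_iff)
    then have qx0: "q x x \<noteq> 0" by auto
    define W where "W = {v + c *s x | v c. v \<in> V}"
    have W_I: "v + c *s x \<in> W" if "v \<in> V" for v c using that by (auto simp: W_def)
    have VW: "v \<in> W" if "v \<in> V" for v using W_I[OF that, of 0] by simp
    have xW: "x \<in> W" using W_I[OF clV(4), of 1] by simp
    have "vec.subspace W"
      unfolding vec.subspace_def
    proof (intro conjI ballI allI)
      show "0 \<in> W" using clV(4) by (rule VW)
    next
      fix a b assume "a \<in> W" "b \<in> W"
      then obtain v c v' c' where "v \<in> V" "v' \<in> V" "a = v + c *s x" "b = v' + c' *s x"
        by (auto simp: W_def)
      moreover from this have "a + b = (v + v') + (c + c') *s x" by (simp add: vector_sadd_rdistrib)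
      ultimately show "a + b \<in> W" using W_I clV(1) by metis
    next
      fix d a assume "a \<in> W"
      then obtain v c where "v \<in> V" "a = v + c *s x" by (auto simp: W_def)
      moreover from this have "d *s a = d *s v + (d * c) *s x" by (simp add: vector_add_ldistrib)
      ultimately show "d *s a \<in> W" using W_I clV(3) by metis
    qed
    moreover have "M *v a \<in> W" if "a \<in> W" for a
    proof -
      from that obtain v c where vc: "v \<in> V" "a = v + c *s x" by (auto simp: W_def)
      then have "M *v a = (M *v v + c *s w) + (c * \<nu>) *s x"
        by (simp add: matrix_vector_right_distrib vector_scalar_commute Mx vector_add_ldistrib)
      moreover have "M *v v + c *s w \<in> V" 
        by (rule clV(1)[OF invV[OF vc(1)] clV(3)[OF w]])
      ultimately show ?thesis by (simp only: W_I)
    qed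
    moreover have "0 < Re (q a a)" if "a \<in> W" "a \<noteq> 0" for a
    proof -
      from that obtain v c where vc: "v \<in> V" "a = v + c *s x" by (auto simp: W_def)
      have "q a a = q v v + (c * cnj c) * q x x" by (simp add: vc q_simps orth)
      also have "c * cnj c = complex_of_real ((cmod c)\<^sup>2)" by (rule complex_norm_square[symmetric])
      finally have qa: "Re (q a a) = Re (q v v) + (cmod c)\<^sup>2 * Re (q x x)"
        by (simp del: of_real_power)
      show ?thesis
      proof (cases "v = 0")
        case True
        then have "c \<noteq> 0" using vc that by auto
        then show ?thesis using qa True qx by (simp add: q_simps)
      next
        case False
        then show ?thesis using qa posV[OF vc(1)] qx by (simp add: add_pos_nonneg)
      qed
    qed
    moreover have "\<exists>v\<in>W. \<forall>u\<in>W. q u (a - v) = 0" for a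
    proof -
      obtain v where v: "v \<in> V" "\<And>u. u \<in> V \<Longrightarrow> q u (a - v) = 0" using projV by blast
      \<comment> \<open>one further Gram-Schmidt step, from \<open>V\<close> to \<open>W\<close>\<close>
      define c where "c = q x (a - v) / q x x"
      have "q (u + d *s x) (a - (v + c *s x)) = 0" if "u \<in> V" for u d
      proof -
        have "a - (v + c *s x) = (a - v) - c *s x" by simp
        then have "q (u + d *s x) (a - (v + c *s x))
          = q u (a - v) - c * q u x + cnj d * (q x (a - v) - c * q x x)"
          by (simp only: q_simps) (simp add: algebra_simps)
        then show ?thesis using v(2)[OF that] orth[OF that] qx0 by (simp add: c_def)
      qed
      then have "q u (a - (v + c *s x)) = 0" if "u \<in> W" for u using that by (auto simp: W_def)
      then show ?thesis using W_I[OF v(1), of c] by blast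
    qed
    ultimately have "good W" by (auto simp: good_def)
    moreover have "V \<subset> W"
    proof
      show "V \<subseteq> W" using VW by blast
      show "V \<noteq> W" using xW \<open>x \<notin> V\<close> by blast
    qed
    then have "vec.dim V < vec.dim W"
      using vec.dim_psubset[of V W] subV \<open>vec.subspace W\<close> by (simp add: vec.span_eq_iff[THEN iffD2])
    ultimately show False using maximal by force
  qed
  then show ?thesis using posV \<open>x \<noteq> 0\<close> by (simp add: q_def)
qed

section \<open>Real systems and the H-infinity norm\<close>

abbreviation complexify :: "real ^ 'n ^ 'm \<Rightarrow> complex ^ 'n ^ 'm"
  where "complexify M \<equiv> map_matrix complex_of_real M"

definition complex_vec :: "real ^ 'n \<Rightarrow> complex ^ 'n"
  where "complex_vec x = (\<chi> k. complex_of_real (x $ k))"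

definition Re_vec :: "complex ^ 'n \<Rightarrow> real ^ 'n"
  where "Re_vec x = (\<chi> k. Re (x $ k))"

definition Im_vec :: "complex ^ 'n \<Rightarrow> real ^ 'n"
  where "Im_vec x = (\<chi> k. Im (x $ k))"

lemma Re_vec_complexify: "Re_vec (complexify M *v x) = M *v Re_vec x"
  and Im_vec_complexify: "Im_vec (complexify M *v x) = M *v Im_vec x"
  and complexify_complex_vec: "complexify M *v complex_vec y = complex_vec (M *v y)"
  by (simp_all add: Re_vec_def Im_vec_def complex_vec_def matrix_vector_mult_def vec_eq_iff)

lemma inner_Re_vec_Im_vec: "x \<bullet> y = Re_vec x \<bullet> Re_vec y + Im_vec x \<bullet> Im_vec y"
  by (simp add: Re_vec_def Im_vec_def inner_vec_def inner_complex_def sum.distrib)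

lemma vec_eq_0_iff_parts: "x = 0 \<longleftrightarrow> Re_vec x = 0 \<and> Im_vec x = 0"
  by (auto simp: Re_vec_def Im_vec_def vec_eq_iff complex_eq_iff)

lemma parts_complex_vec [simp]: "Re_vec (complex_vec x) = x" "Im_vec (complex_vec x) = 0"
  by (simp_all add: Re_vec_def Im_vec_def complex_vec_def vec_eq_iff)

lemma norm_complex_vec [simp]: "norm (complex_vec x) = norm x"
  by (simp add: norm_eq_sqrt_inner inner_Re_vec_Im_vec)

lemma complex_vec_add: "complex_vec (x + y) = complex_vec x + complex_vec y"
  by (simp add: complex_vec_def vec_eq_iff)

lemma hdot_complex_vec:
  "hdot y (complex_vec x) = Complex (Re_vec y \<bullet> x) (- (Im_vec y \<bullet> x))"
  by (simp add: hdot_def complex_vec_def Re_vec_def Im_vec_def inner_vec_def complex_eq_iff sum_negf)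

lemma matrix_vector_mult_minus:
  fixes M :: "'a::ring_1 ^ 'n ^ 'm"
  shows "(- M) *v x = - (M *v x)"
  by (simp add: vec_eq_iff matrix_vector_mult_def sum_negf)

lemma inner_symmetric_matrix:
  fixes X :: "real ^ 'n ^ 'n"
  assumes "transpose X = X"
  shows "(X *v x) \<bullet> y = x \<bullet> (X *v y)"
  by (metis assms dot_lmul_matrix transpose_matrix_vector)

text \<open>The real form: a real matrix acts separately on real and imaginary parts, so the decay condition passes from real to
  complex vectors.\<close>

lemma lyapunov_positive:
  fixes A X :: "real ^ 'n ^ 'n"
  assumes "hurwitz A" and sym: "transpose X = X"
    and decay: "\<And>x. x \<noteq> 0 \<Longrightarrow> x \<bullet> (X *v (A *v x)) < 0"
    and "x \<noteq> 0"
  shows "0 < x \<bullet> (X *v x)"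
proof -
  have "0 < Re (hdot (complex_vec x) (complexify X *v complex_vec x))"
  proof (rule lyapunov_form_positive[of "complexify A"])
    show "Re \<mu> < 0" if "is_eigenvalue (complexify A) \<mu>" for \<mu>
      using that assms(1) by (simp add: hurwitz_def)
  next
    fix x y :: "complex ^ 'n"
    have "conj_transpose (complexify X) = complexify X"
      using sym by (simp add: conj_transpose_def vec_eq_iff transpose_def)
    then show "hdot x (complexify X *v y) = cnj (hdot y (complexify X *v x))"
      by (metis cnj_hdot hdot_conj_transpose)
  next
    fix x :: "complex ^ 'n" assume "x \<noteq> 0"
    have nonpos: "a \<bullet> (X *v (A *v a)) \<le> 0" for a using decay[of a] by (cases "a = 0") auto
    have "Re_vec x \<noteq> 0 \<or> Im_vec x \<noteq> 0" using \<open>x \<noteq> 0\<close> vec_eq_0_iff_parts by blast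
    then show "Re (hdot x (complexify X *v (complexify A *v x))) < 0"
      using decay[of "Re_vec x"] decay[of "Im_vec x"] nonpos[of "Re_vec x"] nonpos[of "Im_vec x"]
      unfolding Re_hdot inner_Re_vec_Im_vec[of x] Re_vec_complexify Im_vec_complexify by linarith
  next
    show "complex_vec x \<noteq> 0" using \<open>x \<noteq> 0\<close> by (simp add: vec_eq_0_iff_parts)
  qed
  then show ?thesis by (simp add: Re_hdot inner_Re_vec_Im_vec complexify_complex_vec)
qed

lemma matrix_inv_cancel:
  fixes M :: "'a::field ^ 'n ^ 'n"
  assumes "invertible M"
  shows "M ** matrix_inv M = mat 1" and "matrix_inv M ** M = mat 1"
  using someI_ex[OF assms[unfolded invertible_def]] by (auto simp: matrix_inv_def)

lemma resolvent_solution: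
  fixes A :: "real ^ 'n ^ 'n"
  assumes "hurwitz A" "0 \<le> Re s" and eq: "complexify A *v u + d = s *s u"
  shows "u = matrix_inv (mat s - complexify A) *v d"
proof -
  let ?R = "mat s - complexify A"
  have mat: "?R *v x = s *s x - complexify A *v x" for x
    by (simp add: matrix_vector_mult_diff_rdistrib mat_vector_mult)
  have "x = 0" if "?R *v x = 0" for x
  proof (rule ccontr)
    assume "x \<noteq> 0"
    then have "is_eigenvalue (complexify A) s" using that by (auto simp: mat is_eigenvalue_def)
    then show False using assms(1,2) by (force simp: hurwitz_def)
  qed
  then have "invertible ?R" by (simp add: invertible_left_inverse matrix_left_invertible_ker)
  then have "u = matrix_inv ?R *v (?R *v u)"
    by (simp add: matrix_vector_mul_assoc matrix_inv_cancel)
  also have "?R *v u = d" unfolding mat eq[symmetric] by simp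
  finally show ?thesis .
qed

text \<open>On the imaginary axis the relation \<open>A u + B v = \<i> \<omega> u\<close> means \<open>u = (\<i> \<omega> - A)\<^sup>-\<^sup>1 B v\<close>, so a bound on the transfer
  matrix is the frequency bound required above. Only the norm of \<open>G s *v v\<close> is prescribed, which leaves the
  sign of the transfer matrix free.\<close>

lemma hinf_energy_bound:
  fixes A :: "real ^ 'k ^ 'k" and B :: "real ^ 'm ^ 'k"
    and f :: "'i \<Rightarrow> real ^ 'k" and g :: "'i \<Rightarrow> real ^ 'm"
  assumes A: "hurwitz A" and I: "finite I"
    and skew: "\<And>y. (\<Sum>i\<in>I. (y \<bullet> (A *v f i + B *v g i)) * (y \<bullet> f i)) = 0"
    and G: "\<And>s v. norm (G s *v v) = norm ((matrix_inv (mat s - complexify A) ** complexify B) *v v)"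
    and bound: "\<And>s. 0 \<le> Re s \<Longrightarrow> norm2 (G s) \<le> \<kappa>"
  shows "(\<Sum>i\<in>I. (norm (f i))\<^sup>2) \<le> \<kappa>\<^sup>2 * (\<Sum>i\<in>I. (norm (g i))\<^sup>2)"
proof -
  have "(\<Sum>i\<in>I. (norm (complex_vec (f i)))\<^sup>2) \<le> \<kappa>\<^sup>2 * (\<Sum>i\<in>I. (norm (complex_vec (g i)))\<^sup>2)"
  proof (rule frequency_domain_energy_bound[OF I])
    fix y :: "complex ^ 'k"
    let ?w = "\<lambda>i. A *v f i + B *v g i"
    have "Re (\<Sum>i\<in>I. hdot y (complexify A *v complex_vec (f i) + complexify B *v complex_vec (g i))
        * hdot (complex_vec (f i)) y)
      = (\<Sum>i\<in>I. (Re_vec y \<bullet> ?w i) * (Re_vec y \<bullet> f i)) + (\<Sum>i\<in>I. (Im_vec y \<bullet> ?w i) * (Im_vec y \<bullet> f i))"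
      unfolding complexify_complex_vec complex_vec_add[symmetric] cnj_hdot[of y, symmetric] hdot_complex_vec
      by (simp add: sum.distrib)
    then show "Re (\<Sum>i\<in>I. hdot y (complexify A *v complex_vec (f i) + complexify B *v complex_vec (g i))
        * hdot (complex_vec (f i)) y) = 0"
      using skew by simp
  next
    fix \<omega> u v
    assume "complexify A *v u + complexify B *v v = (\<i> * complex_of_real \<omega>) *s u"
    then have "u = (matrix_inv (mat (\<i> * \<omega>) - complexify A) ** complexify B) *v v"
      using resolvent_solution[OF A, of "\<i> * \<omega>" u "complexify B *v v"]
      by (simp add: matrix_vector_mul_assoc)
    then have "norm u = norm (G (\<i> * \<omega>) *v v)" using G by simp
    also have "\<dots> \<le> norm2 (G (\<i> * \<omega>)) * norm v" by (rule norm_matrix_vector_le_norm2)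
    also have "\<dots> \<le> \<kappa> * norm v" using bound by (intro mult_right_mono) simp_all
    finally show "norm u \<le> \<kappa> * norm v" .
  qed
  then show ?thesis by simp
qed

text \<open>Choosing a real number strictly between the norm and \<open>c\<close> avoids any case distinction on whether the
  extended-real supremum is finite.\<close>

lemma norm2_le_of_hinf_norm_less:
  assumes "hinf_norm G < ereal c"
  obtains \<kappa> where "0 \<le> \<kappa>" "\<kappa> < c" "\<And>s. 0 \<le> Re s \<Longrightarrow> norm2 (G s) \<le> \<kappa>"
proof -
  obtain \<kappa> where \<kappa>: "hinf_norm G < ereal \<kappa>" "ereal \<kappa> < ereal c"
    using ereal_dense2[OF assms] by blast
  have bound: "norm2 (G s) \<le> \<kappa>" if "0 \<le> Re s" for s
  proof -
    have "ereal (norm2 (G s)) \<le> hinf_norm G"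
      unfolding hinf_norm_def using that by (intro SUP_upper) simp
    then show ?thesis using \<kappa>(1) by (metis ereal_less_eq(3) less_imp_le order_trans)
  qed
  then have "0 \<le> \<kappa>" using norm_matrix_vector_le_norm2(1)[of "G 0"] bound[of 0] by (auto intro: order_trans)
  then show ?thesis using that \<kappa>(2) bound by simp
qed

section \<open>Duality for block-diagonal Lyapunov inequalities\<close>

definition upper :: "real ^ ('k1::finite + 'k2::finite) \<Rightarrow> real ^ 'k1"
  where "upper x = (\<chi> i. x $ Inl i)"

definition lower :: "real ^ ('k1::finite + 'k2::finite) \<Rightarrow> real ^ 'k2"
  where "lower x = (\<chi> i. x $ Inr i)"

definition join :: "real ^ 'k1 \<Rightarrow> real ^ 'k2 \<Rightarrow> real ^ ('k1::finite + 'k2::finite)"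
  where "join a b = (\<chi> k. case k of Inl i \<Rightarrow> a $ i | Inr j \<Rightarrow> b $ j)"

lemma upper_join [simp]: "upper (join a b) = a" and lower_join [simp]: "lower (join a b) = b"
  by (simp_all add: upper_def lower_def join_def)

lemma sum_UNIV_sum_type:
  fixes h :: "'a::finite + 'b::finite \<Rightarrow> 'c::comm_monoid_add"
  shows "(\<Sum>k\<in>UNIV. h k) = (\<Sum>i\<in>UNIV. h (Inl i)) + (\<Sum>j\<in>UNIV. h (Inr j))"
  unfolding UNIV_Plus_UNIV[symmetric] by (subst sum.Plus) simp_all

lemma inner_upper_lower: "x \<bullet> y = upper x \<bullet> upper y + lower x \<bullet> lower y"
  by (simp add: inner_vec_def sum_UNIV_sum_type upper_def lower_def)

lemma upper_mult: "upper (A *v x) = block11 A *v upper x + block12 A *v lower x"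
  and lower_mult: "lower (A *v x) = block21 A *v upper x + block22 A *v lower x"
  by (simp_all add: vec_eq_iff upper_def lower_def matrix_vector_mult_def sum_UNIV_sum_type
      block11_def block12_def block21_def block22_def)

lemma linear_upper: "linear upper" and linear_lower: "linear lower"
  by (auto intro!: linearI simp: upper_def lower_def vec_eq_iff)

definition outer :: "real ^ 'n \<Rightarrow> real ^ 'm \<Rightarrow> real ^ 'm ^ 'n"
  where "outer a b = (\<chi> i j. a $ i * b $ j)"

lemma inner_outer: "X \<bullet> outer a b = a \<bullet> (X *v b)"
  by (simp add: inner_vec_def outer_def matrix_vector_mult_def sum_distrib_left mult_ac)

lemma outer_mult: "y \<bullet> (outer a b *v y) = (y \<bullet> a) * (y \<bullet> b)"
proof -
  have "outer a b *v y = (b \<bullet> y) *\<^sub>R a"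
    by (simp add: vec_eq_iff outer_def matrix_vector_mult_def inner_vec_def sum_distrib_left mult_ac)
  then show ?thesis by (simp add: inner_commute)
qed

definition sym_outer :: "real ^ 'n \<Rightarrow> real ^ 'n \<Rightarrow> real ^ 'n ^ 'n"
  where "sym_outer a b = outer a b + outer b a"

text \<open>Pairing a matrix with \<open>sym_outer\<close> sees only its symmetric part, so separating functionals can be taken to be
  symmetric matrices.\<close>

lemma inner_sym_outer: "X \<bullet> sym_outer a b = a \<bullet> ((X + transpose X) *v b)"
proof -
  have "b \<bullet> (X *v a) = a \<bullet> (transpose X *v b)"
    by (metis dot_lmul_matrix inner_commute transpose_matrix_vector)
  then show ?thesis
    by (simp add: sym_outer_def inner_add_right inner_outer matrix_vector_mult_add_rdistrib)
qed

lemma sym_outer_quadratic: "y \<bullet> (sym_outer a b *v y) = 2 * ((y \<bullet> b) * (y \<bullet> a))"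
  by (simp add: sym_outer_def matrix_vector_mult_add_rdistrib inner_add_right outer_mult)

lemma weighted_sym_outer_zero:
  assumes zero: "(\<Sum>i\<in>I. c i *\<^sub>R sym_outer (a i) (b i)) = 0"
    and nonneg: "\<And>i. i \<in> I \<Longrightarrow> 0 \<le> c i"
  shows "(\<Sum>i\<in>I. (y \<bullet> (sqrt (c i) *\<^sub>R b i)) * (y \<bullet> (sqrt (c i) *\<^sub>R a i))) = 0"
proof -
  have "0 = y \<bullet> ((\<Sum>i\<in>I. c i *\<^sub>R sym_outer (a i) (b i)) *v y)" by (simp add: zero)
  also have "\<dots> = (\<Sum>i\<in>I. c i * (y \<bullet> (sym_outer (a i) (b i) *v y)))"
    by (induction I rule: infinite_finite_induct)
      (simp_all add: matrix_vector_mult_add_rdistrib inner_add_right scaleR_matrix_vector_assoc[symmetric])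
  also have "\<dots> = (\<Sum>i\<in>I. 2 * ((y \<bullet> (sqrt (c i) *\<^sub>R b i)) * (y \<bullet> (sqrt (c i) *\<^sub>R a i))))"
    using nonneg by (intro sum.cong refl) (simp add: sym_outer_quadratic)
  finally show ?thesis by (simp flip: sum_distrib_left)
qed

text \<open>A theorem of the alternative for the inequality \<open>X A + A\<^sup>T X < 0\<close> in symmetric block-diagonal \<open>X\<close>. For
  \<open>X\<close> with blocks \<open>X1\<close>, \<open>X2\<close>, the number \<open>2 (x \<bullet> X A x)\<close> is the inner product of \<open>(X1, X2)\<close> with the pair \<open>\<phi> x\<close> of
  symmetrised outer products. Hence a solution is a functional negative on the compact convex hull of the image
  of the unit sphere, and it exists unless 0 is in this hull. In that case a convex combination
  \<open>\<Sum> c i * \<phi> (e i)\<close> vanishes, and the vectors \<open>sqrt (c i) * e i\<close> form the excluded family. No sign is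
  imposed on \<open>X1\<close> and \<open>X2\<close>; this is why the family satisfies equations and not merely inequalities.\<close>

lemma block_lyapunov_alternative:
  fixes A :: "real ^ ('k1::finite + 'k2::finite) ^ ('k1 + 'k2)"
  assumes no_family: "\<And>(I :: ((real ^ 'k1 ^ 'k1) \<times> (real ^ 'k2 ^ 'k2)) set) x. finite I \<Longrightarrow>
      (\<And>y. (\<Sum>i\<in>I. (y \<bullet> upper (A *v x i)) * (y \<bullet> upper (x i))) = 0) \<Longrightarrow>
      (\<And>y. (\<Sum>i\<in>I. (y \<bullet> lower (A *v x i)) * (y \<bullet> lower (x i))) = 0) \<Longrightarrow>
      (\<Sum>i\<in>I. (norm (x i))\<^sup>2) = 0"
  obtains X1 :: "real ^ 'k1 ^ 'k1" and X2 :: "real ^ 'k2 ^ 'k2"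
  where "transpose X1 = X1" "transpose X2 = X2"
    "\<And>x. x \<noteq> 0 \<Longrightarrow> upper x \<bullet> (X1 *v upper (A *v x)) + lower x \<bullet> (X2 *v lower (A *v x)) < 0"
proof -
  define \<phi> where "\<phi> x = (sym_outer (upper x) (upper (A *v x)), sym_outer (lower x) (lower (A *v x)))" for x
  define C where "C = convex hull (\<phi> ` sphere 0 1)"
  have "linear (\<lambda>x. upper (A *v x))" "linear (\<lambda>x. lower (A *v x))"
    using linear_compose[OF matrix_vector_mul_linear[of A] linear_upper]
      linear_compose[OF matrix_vector_mul_linear[of A] linear_lower] by (simp_all add: o_def)
  then have cont: "continuous_on S upper" "continuous_on S lower"
    "continuous_on S (\<lambda>x. upper (A *v x))" "continuous_on S (\<lambda>x. lower (A *v x))" for S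
    using linear_upper linear_lower
    by (auto simp only: linear_conv_bounded_linear intro: linear_continuous_on)
  have "continuous_on (sphere 0 1) \<phi>"
    unfolding \<phi>_def sym_outer_def outer_def by (intro continuous_intros cont)
  then have "compact C" unfolding C_def
    by (intro compact_convex_hull compact_continuous_image) simp_all
  moreover have "convex C" by (simp add: C_def)
  moreover have "0 \<notin> C"
  proof
    assume "0 \<in> C"
    then obtain I c where I: "finite I" "I \<subseteq> \<phi> ` sphere 0 1" "\<And>i. i \<in> I \<Longrightarrow> 0 \<le> c i" "sum c I = 1"
      "(\<Sum>i\<in>I. c i *\<^sub>R i) = 0"
      unfolding C_def convex_hull_explicit by blast
    define e where "e i = (SOME x. x \<in> sphere 0 1 \<and> \<phi> x = i)" for i
    have e: "norm (e i) = 1" "\<phi> (e i) = i" if "i \<in> I" for i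
    proof -
      have "\<exists>x. x \<in> sphere 0 1 \<and> \<phi> x = i" using I(2) that by blast
      from someI_ex[OF this] show "norm (e i) = 1" "\<phi> (e i) = i" by (simp_all add: e_def)
    qed
    define x where "x i = sqrt (c i) *\<^sub>R e i" for i
    have "(\<Sum>i\<in>I. (norm (x i))\<^sup>2) = sum c I"
      using I(3) e(1) by (intro sum.cong refl) (simp add: x_def power_mult_distrib)
    moreover have "(\<Sum>i\<in>I. (y \<bullet> upper (A *v x i)) * (y \<bullet> upper (x i))) = 0" for y
    proof -
      have "(\<Sum>i\<in>I. c i *\<^sub>R sym_outer (upper (e i)) (upper (A *v e i))) = (\<Sum>i\<in>I. c i *\<^sub>R fst i)"
        using e(2) by (intro sum.cong refl) (metis \<phi>_def fst_conv)
      also have "\<dots> = 0" using arg_cong[OF I(5), of fst] by (simp add: fst_sum)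
      finally show ?thesis
        using weighted_sym_outer_zero[OF _ I(3)]
        by (simp add: x_def matrix_vector_mult_scaleR linear_cmul[OF linear_upper])
    qed
    moreover have "(\<Sum>i\<in>I. (y \<bullet> lower (A *v x i)) * (y \<bullet> lower (x i))) = 0" for y
    proof -
      have "(\<Sum>i\<in>I. c i *\<^sub>R sym_outer (lower (e i)) (lower (A *v e i))) = (\<Sum>i\<in>I. c i *\<^sub>R snd i)"
        using e(2) by (intro sum.cong refl) (metis \<phi>_def snd_conv)
      also have "\<dots> = 0" using arg_cong[OF I(5), of snd] by (simp add: snd_sum)
      finally show ?thesis
        using weighted_sym_outer_zero[OF _ I(3)]
        by (simp add: x_def matrix_vector_mult_scaleR linear_cmul[OF linear_lower])
    qed
    ultimately show False using no_family[OF I(1), of x] I(4) by simp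
  qed
  ultimately obtain a b where ab: "0 < b" "\<And>z. z \<in> C \<Longrightarrow> b < a \<bullet> z"
    using separating_hyperplane_closed_0[of C] compact_imp_closed by blast
  obtain a1 a2 where a: "a = (a1, a2)" by (cases a)
  define X1 where "X1 = - (a1 + transpose a1)"
  define X2 where "X2 = - (a2 + transpose a2)"
  define F where "F x = upper x \<bullet> (X1 *v upper (A *v x)) + lower x \<bullet> (X2 *v lower (A *v x))" for x
  have neg_unit: "F x < 0" if "norm x = 1" for x
  proof -
    have "\<phi> x \<in> C" unfolding C_def using that by (intro hull_inc imageI) simp
    then have "0 < a \<bullet> \<phi> x" using ab by (meson order_less_trans)
    then show ?thesis
      by (simp add: F_def a \<phi>_def inner_sym_outer X1_def X2_def matrix_vector_mult_minus del: minus_add_distrib)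
  qed
  have "F x < 0" if "x \<noteq> 0" for x
  proof -
    have "F (r *\<^sub>R x) = r\<^sup>2 * F x" for r
      by (simp add: F_def linear_cmul[OF linear_upper] linear_cmul[OF linear_lower]
          matrix_vector_mult_scaleR power2_eq_square algebra_simps)
    then have "(inverse (norm x))\<^sup>2 * F x < 0" using neg_unit[of "inverse (norm x) *\<^sub>R x"] that by simp
    then show ?thesis by (simp add: mult_less_0_iff)
  qed
  moreover have "transpose X1 = X1" "transpose X2 = X2"
    by (simp_all add: X1_def X2_def vec_eq_iff transpose_def)
  ultimately show ?thesis using that by (simp add: F_def)
qed

section \<open>The small-gain argument\<close>

lemma symmetric_inverse_of_positive:
  fixes X :: "real ^ 'n ^ 'n"
  assumes sym: "transpose X = X" and pos: "\<And>x. x \<noteq> 0 \<Longrightarrow> 0 < x \<bullet> (X *v x)"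
  obtains P where "transpose P = P" "\<And>x. X *v (P *v x) = x" "\<And>x. x \<noteq> 0 \<Longrightarrow> 0 < x \<bullet> (P *v x)"
proof -
  have "x = 0" if "X *v x = 0" for x using pos[of x] that by force
  then have inv: "invertible X" by (simp add: invertible_left_inverse matrix_left_invertible_ker)
  define P where "P = matrix_inv X"
  have XP: "X ** P = mat 1" "P ** X = mat 1" using inv by (simp_all add: P_def matrix_inv_cancel)
  have "transpose P ** X = mat 1" using arg_cong[OF XP(1), of transpose] sym
    by (simp add: matrix_transpose_mul)
  then have "transpose P = P" using XP by (metis matrix_mul_assoc matrix_mul_lid matrix_mul_rid)
  moreover have XPx: "X *v (P *v x) = x" for x using XP by (simp add: matrix_vector_mul_assoc)
  moreover have "0 < x \<bullet> (P *v x)" if "x \<noteq> 0" for x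
    using pos[of "P *v x"] XPx[of x] that by (metis inner_commute matrix_vector_mult_0_right)
  ultimately show ?thesis using that by blast
qed

definition block_diag :: "real ^ 'k1 ^ 'k1 \<Rightarrow> real ^ 'k2 ^ 'k2 \<Rightarrow> real ^ ('k1::finite + 'k2::finite) ^ ('k1 + 'k2)"
  where "block_diag P1 P2 = (\<chi> i. case i of Inl i' \<Rightarrow> join (P1 $ i') 0 | Inr i' \<Rightarrow> join 0 (P2 $ i'))"

lemma blocks_block_diag [simp]:
  "block11 (block_diag P1 P2) = P1" "block12 (block_diag P1 P2) = 0"
  "block21 (block_diag P1 P2) = 0" "block22 (block_diag P1 P2) = P2"
  by (simp_all add: block11_def block12_def block21_def block22_def block_diag_def join_def vec_eq_iff)

lemma transpose_block_diag:
  "transpose (block_diag P1 P2) = block_diag (transpose P1) (transpose P2)"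
  by (simp add: transpose_def block_diag_def join_def vec_eq_iff split: sum.split)

theorem proposition5:
  fixes A :: "real ^ ('k1::finite + 'k2::finite) ^ ('k1 + 'k2)"
  assumes "hurwitz (block11 A)" and "hurwitz (block22 A)"
    and "\<exists>\<gamma>::real. 0 < \<gamma> \<and> hinf_norm (K1 A) < ereal (1 / \<gamma>) \<and> hinf_norm (K2 A) < ereal \<gamma>"
  shows "alpha_diagonally_stable A"
proof -
  obtain \<gamma> where \<gamma>: "0 < \<gamma>" "hinf_norm (K1 A) < ereal (1 / \<gamma>)" "hinf_norm (K2 A) < ereal \<gamma>"
    using assms(3) by blast
  obtain \<kappa>1 where \<kappa>1: "0 \<le> \<kappa>1" "\<kappa>1 < 1 / \<gamma>" "\<And>s. 0 \<le> Re s \<Longrightarrow> norm2 (K1 A s) \<le> \<kappa>1"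
    using norm2_le_of_hinf_norm_less[OF \<gamma>(2)] by blast
  obtain \<kappa>2 where \<kappa>2: "0 \<le> \<kappa>2" "\<kappa>2 < \<gamma>" "\<And>s. 0 \<le> Re s \<Longrightarrow> norm2 (K2 A s) \<le> \<kappa>2"
    using norm2_le_of_hinf_norm_less[OF \<gamma>(3)] by blast
  have small_gain: "\<kappa>1 * \<kappa>2 < 1"
    using mult_strict_mono[OF \<kappa>1(2) \<kappa>2(2)] \<kappa>1(1) \<kappa>2(1) \<gamma>(1) by simp
  obtain X1 :: "real ^ 'k1 ^ 'k1" and X2 :: "real ^ 'k2 ^ 'k2"
    where sym: "transpose X1 = X1" "transpose X2 = X2"
    and decay: "\<And>x. x \<noteq> 0 \<Longrightarrow> upper x \<bullet> (X1 *v upper (A *v x)) + lower x \<bullet> (X2 *v lower (A *v x)) < 0"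
  proof (rule block_lyapunov_alternative[of A])
    fix I :: "((real ^ 'k1 ^ 'k1) \<times> (real ^ 'k2 ^ 'k2)) set" and x
    assume I: "finite I"
      and skew1: "\<And>y. (\<Sum>i\<in>I. (y \<bullet> upper (A *v x i)) * (y \<bullet> upper (x i))) = 0"
      and skew2: "\<And>y. (\<Sum>i\<in>I. (y \<bullet> lower (A *v x i)) * (y \<bullet> lower (x i))) = 0"
    define E1 where "E1 = (\<Sum>i\<in>I. (norm (upper (x i)))\<^sup>2)"
    define E2 where "E2 = (\<Sum>i\<in>I. (norm (lower (x i)))\<^sup>2)"
    have E1: "E1 \<le> \<kappa>1\<^sup>2 * E2"
      unfolding E1_def E2_def
    proof (rule hinf_energy_bound[OF assms(1) I, where G = "K1 A" and B = "block12 A"])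
      show "norm (K1 A s *v v) = norm ((matrix_inv (mat s - complexify (block11 A)) ** complexify (block12 A)) *v v)"
        for s v
        by (simp add: K1_def matrix_vector_mult_minus)
    qed (use skew1 \<kappa>1(3) in \<open>simp_all add: upper_mult\<close>)
    have E2: "E2 \<le> \<kappa>2\<^sup>2 * E1"
      unfolding E1_def E2_def
      by (rule hinf_energy_bound[OF assms(2) I, where G = "K2 A" and B = "block21 A"])
        (use skew2 \<kappa>2(3) in \<open>simp_all add: lower_mult K2_def add.commute\<close>)
    \<comment> \<open>small gain: going once round the loop contracts the energy\<close>
    have "E1 \<le> (\<kappa>1 * \<kappa>2)\<^sup>2 * E1"
      using E1 mult_left_mono[OF E2, of "\<kappa>1\<^sup>2"] by (simp add: power_mult_distrib mult.assoc)
    moreover have "(\<kappa>1 * \<kappa>2)\<^sup>2 < 1"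
      using small_gain \<kappa>1(1) \<kappa>2(1) by (simp add: power_less_one_iff abs_square_less_1)
    moreover have nonneg: "0 \<le> E1" "0 \<le> E2" by (simp_all add: E1_def E2_def sum_nonneg)
    ultimately have "\<not> 0 < E1"
      using mult_strict_right_mono[of "(\<kappa>1 * \<kappa>2)\<^sup>2" 1 E1] by linarith
    then have "E1 = 0" using nonneg by linarith
    then have "E2 = 0" using E2 nonneg by simp
    have "(\<Sum>i\<in>I. (norm (x i))\<^sup>2) = E1 + E2"
      by (simp add: E1_def E2_def power2_norm_eq_inner inner_upper_lower sum.distrib)
    then show "(\<Sum>i\<in>I. (norm (x i))\<^sup>2) = 0" using \<open>E1 = 0\<close> \<open>E2 = 0\<close> by simp
  qed blast
  have join_nz: "join y z \<noteq> 0" if "y \<noteq> 0 \<or> z \<noteq> 0" for y :: "real ^ 'k1" and z :: "real ^ 'k2"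
    using that linear_0[OF linear_upper] linear_0[OF linear_lower] by (metis lower_join upper_join)
  \<comment> \<open>restricted to vectors supported in one block, the joint inequality is a Lyapunov inequality for
    the diagonal block, and this forces positivity\<close>
  have pos1: "0 < y \<bullet> (X1 *v y)" if "y \<noteq> 0" for y
  proof (rule lyapunov_positive[OF assms(1) sym(1) _ that])
    show "y \<bullet> (X1 *v (block11 A *v y)) < 0" if "y \<noteq> 0" for y
      using decay[OF join_nz[of y 0]] that by (simp add: upper_mult)
  qed
  have pos2: "0 < y \<bullet> (X2 *v y)" if "y \<noteq> 0" for y
  proof (rule lyapunov_positive[OF assms(2) sym(2) _ that])
    show "y \<bullet> (X2 *v (block22 A *v y)) < 0" if "y \<noteq> 0" for y
      using decay[OF join_nz[of 0 y]] that by (simp add: lower_mult)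
  qed
  obtain P1 where P1: "transpose P1 = P1" "\<And>x. X1 *v (P1 *v x) = x" "\<And>x. x \<noteq> 0 \<Longrightarrow> 0 < x \<bullet> (P1 *v x)"
    using symmetric_inverse_of_positive[OF sym(1) pos1] by blast
  obtain P2 where P2: "transpose P2 = P2" "\<And>x. X2 *v (P2 *v x) = x" "\<And>x. x \<noteq> 0 \<Longrightarrow> 0 < x \<bullet> (P2 *v x)"
    using symmetric_inverse_of_positive[OF sym(2) pos2] by blast
  \<comment> \<open>passing to inverses turns \<open>X A + A\<^sup>T X < 0\<close> into \<open>A P + P A\<^sup>T < 0\<close>\<close>
  define P where "P = block_diag P1 P2"
  have symP: "transpose P = P" by (simp add: P_def transpose_block_diag P1 P2)
  have Px: "upper (P *v x) = P1 *v upper x" "lower (P *v x) = P2 *v lower x" for x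
    by (simp_all add: upper_mult lower_mult P_def)
  have posP: "0 < x \<bullet> (P *v x)" if "x \<noteq> 0" for x
  proof -
    have "upper x \<noteq> 0 \<or> lower x \<noteq> 0" using that inner_upper_lower[of x x] by auto
    moreover have "0 \<le> upper x \<bullet> (P1 *v upper x)" "0 \<le> lower x \<bullet> (P2 *v lower x)"
      using P1(3) P2(3) by (metis inner_zero_left less_imp_le order_refl)+
    ultimately show ?thesis using P1(3)[of "upper x"] P2(3)[of "lower x"]
      unfolding inner_upper_lower[of x] Px by linarith
  qed
  have "negative_definite (A ** P + P ** transpose A)"
    unfolding negative_definite_def
  proof (intro conjI allI impI)
    have "transpose (M + N) = transpose M + transpose N" for M N :: "real ^ ('k1 + 'k2) ^ ('k1 + 'k2)"
      by (simp add: transpose_def vec_eq_iff)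
    then show "transpose (A ** P + P ** transpose A) = A ** P + P ** transpose A"
      by (simp add: matrix_transpose_mul symP add.commute)
  next
    fix x :: "real ^ ('k1 + 'k2)" assume "x \<noteq> 0"
    define u where "u = P *v x"
    have "u \<noteq> 0" using posP[OF \<open>x \<noteq> 0\<close>] by (auto simp: u_def)
    have "x \<bullet> (P *v (transpose A *v x)) = u \<bullet> (transpose A *v x)"
      by (simp add: u_def inner_symmetric_matrix[OF symP])
    also have "\<dots> = x \<bullet> (A *v u)"
      by (metis dot_lmul_matrix inner_commute transpose_matrix_vector)
    finally have "x \<bullet> ((A ** P + P ** transpose A) *v x) = 2 * (x \<bullet> (A *v u))"
      by (simp add: matrix_vector_mult_add_rdistrib inner_add_right u_def flip: matrix_vector_mul_assoc)
    also have "x \<bullet> (A *v u) = upper u \<bullet> (X1 *v upper (A *v u)) + lower u \<bullet> (X2 *v lower (A *v u))"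
      unfolding inner_upper_lower[of x] inner_symmetric_matrix[OF sym(1), symmetric]
        inner_symmetric_matrix[OF sym(2), symmetric]
      by (simp add: u_def Px P1(2) P2(2))
    finally show "x \<bullet> ((A ** P + P ** transpose A) *v x) < 0" using decay[OF \<open>u \<noteq> 0\<close>] by simp
  qed
  moreover have "alpha_diagonal P" by (simp add: alpha_diagonal_def P_def)
  moreover have "positive_definite P" using symP posP by (simp add: positive_definite_def)
  ultimately show ?thesis unfolding alpha_diagonally_stable_def by blast
qed

end
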